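(* Let $N$ be a positive integer, let $a\in\{1,2,\ldots,N\}$, and let $r$ be a variable. For formal variables $u,w$, we have $$1+\sum_{k\geq 2n,\ n\geq 1}X_0^r(k,n,n)\,u^{k-2n}w^{2n}=\exp\left\{\sum_{n=2}^\infty\frac{t_{N,a}(n)}{n}\left(\alpha_1^n+\alpha_2^n-\gamma_1^n-\gamma_2^n\right)\right\},$$ where $\alpha_1,\alpha_2$ are determined by $\alpha_1+\alpha_2=u$, $\alpha_1\alpha_2=-rw^2$, and $\gamma_1,\gamma_2$ are determined by $\gamma_1+\gamma_2=u$, $\gamma_1\gamma_2=(1-r)w^2$.
   Context: An index is a finite sequence $\mathbf{k}=(k_1,\ldots,k_n)$ of positive integers. Its weight is $k_1+\cdots+k_n$, its depth is $\operatorname{dep}(\mathbf{k})=n$, and its height is the number of $i$ with $k_i\geq 2$. It is admissible if $k_1>1$. For an admissible index define the multiple $t$-value of level $N$ $$t_{N,a}(\mathbf{k})=\sum_{\substack{m_1>\cdots>m_n>0\\ m_i\equiv a \ (\mathrm{mod}\ N)}}\frac{1}{m_1^{k_1}\cdots m_n^{k_n}}$$ (so $t_{N,a}(n)=\sum_{m>0,\ m\equiv a\,(\mathrm{mod}\ N)}m^{-n}$ in depth one) and the interpolated multiple $t$-value of level $N$ $$t_{N,a}^r(\mathbf{k})=\sum_{\mathbf{p}}r^{\,n-\operatorname{dep}(\mathbf{p})}\,t_{N,a}(\mathbf{p}),$$ where $\mathbf{p}$ runs over all $2^{n-1}$ indices obtained from $(k_1\,\Box\, k_2\,\Box\cdots\Box\,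 k_n)$ by replacing each $\Box$ with either a comma or a plus sign (each choice of replacements counted once). $I_0(k,n,s)$ is the set of all admissible indices of weight $k$, depth $n$ and height $s$, and $X_0^r(k,n,s)=\sum_{\mathbf{k}\in I_0(k,n,s)}t_{N,a}^r(\mathbf{k})$. The identity is one of formal power series in $u,w$; the power sums $\alpha_1^n+\alpha_2^n$ and $\gamma_1^n+\gamma_2^n$ are polynomials in $u,w$ (and $r$) since they are symmetric. *)

theory Defs
  imports
    "HOL-Analysis.Infinite_Sum"
    "HOL-Number_Theory.Cong"
    "HOL-Computational_Algebra.Formal_Power_Series"
    "HOL-Computational_Algebra.Fraction_Field"
    "HOL-Algebra.Algebraic_Closure_Type"
begin

definition is_index :: "nat list \<Rightarrow> bool" where
  "is_index ks \<longleftrightarrow> ks \<noteq> [] \<and> (\<forall>k\<in>set ks. k \<ge> 1)"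

definition admissible :: "nat list \<Rightarrow> bool" where
  "admissible ks \<longleftrightarrow> is_index ks \<and> hd ks > 1"

definition weight :: "nat list \<Rightarrow> nat" where
  "weight ks = sum_list ks"

abbreviation dep :: "nat list \<Rightarrow> nat" where
  "dep ks \<equiv> length ks"

definition height :: "nat list \<Rightarrow> nat" where
  "height ks = card {i. i < length ks \<and> ks ! i \<ge> 2}"

definition I0 :: "nat \<Rightarrow> nat \<Rightarrow> nat \<Rightarrow> nat list set" where
  "I0 k n s = {ks. admissible ks \<and> weight ks = k \<and> dep ks = n \<and> height ks = s}"

definition t_value :: "nat \<Rightarrow> nat \<Rightarrow> nat list \<Rightarrow> real" where
  "t_value N a ks =
     (\<Sum>\<^sub>\<infinity>ms \<in> {ms :: nat list. length ms = length ks \<and> sorted_wrt (>) ms \<and>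
                 (\<forall>m\<in>set ms. m > 0 \<and> [m = a] (mod N))}.
        1 / (\<Prod>i<length ks. real (ms ! i) ^ (ks ! i)))"

text \<open>
  In \<open>fill_boxes ks bs\<close> the list \<open>bs\<close> of length \<open>dep ks - 1\<close> records the replacements of the
  boxes from left to right: \<open>True\<close> stands for a plus sign, \<open>False\<close> for a comma.
\<close>
fun fill_boxes :: "nat list \<Rightarrow> bool list \<Rightarrow> nat list" where
  "fill_boxes (k # k' # ks) (True # bs) = fill_boxes ((k + k') # ks) bs"
| "fill_boxes (k # k' # ks) (False # bs) = k # fill_boxes (k' # ks) bs"
| "fill_boxes ks bs = ks"

text \<open>The interpolation parameter \<open>r\<close> is the indeterminate of \<^typ>\<open>real poly\<close>.\<close>
definition t_interp :: "nat \<Rightarrow> nat \<Rightarrow> nat list \<Rightarrow> real poly" where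
  "t_interp N a ks =
     (\<Sum>bs \<in> {bs :: bool list. length bs = dep ks - 1}.
        Polynomial.monom (t_value N a (fill_boxes ks bs)) (dep ks - dep (fill_boxes ks bs)))"

definition X0 :: "nat \<Rightarrow> nat \<Rightarrow> nat \<Rightarrow> nat \<Rightarrow> nat \<Rightarrow> real poly" where
  "X0 N a k n s = (\<Sum>ks\<in>I0 k n s. t_interp N a ks)"

text \<open>
  The ring of formal power series in \<open>u\<close>, \<open>w\<close> over the polynomials in \<open>r\<close> is taken as the iterated
  ring of series in \<open>w\<close> whose coefficients are series in \<open>u\<close>.
\<close>
type_synonym series = "real poly fps fps"

definition coeff_uw :: "series \<Rightarrow> nat \<Rightarrow> nat \<Rightarrow> real poly" where
  "coeff_uw F i j = fps_nth (fps_nth F j) i"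

definition const_uw :: "real poly \<Rightarrow> series" where
  "const_uw c = fps_const (fps_const c)"

definition var_u :: series where "var_u = fps_const fps_X"
definition var_w :: series where "var_w = fps_X"
definition var_r :: series where "var_r = const_uw [:0, 1:]"

text \<open>
  Formal infinite sums: every monomial in \<open>u\<close>, \<open>w\<close> occurs in only finitely many members of the
  family. The topology that the library puts on \<^typ>\<open>series\<close> is not suitable here, since it
  is the \<open>w\<close>-adic one.
\<close>
definition has_formal_sum :: "('i \<Rightarrow> series) \<Rightarrow> 'i set \<Rightarrow> series \<Rightarrow> bool" where
  "has_formal_sum f A S \<longleftrightarrow>
     (\<forall>i j. finite {x\<in>A. coeff_uw (f x) i j \<noteq> 0} \<and>
            coeff_uw S i j = (\<Sum>x \<in> {x\<in>A. coeff_uw (f x) i j \<noteq> 0}. coeff_uw (f x) i j))"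

definition formal_sum :: "('i \<Rightarrow> series) \<Rightarrow> 'i set \<Rightarrow> series" where
  "formal_sum f A = (THE S. has_formal_sum f A S)"

lemma formal_sum_eqI:
  assumes "has_formal_sum f A S"
  shows "formal_sum f A = S"
  unfolding formal_sum_def
proof (rule the_equality)
  fix T assume "has_formal_sum f A T"
  with assms show "T = S"
    by (auto simp: has_formal_sum_def coeff_uw_def intro!: fps_ext)
qed fact

definition exp_uw :: "series \<Rightarrow> series" where
  "exp_uw F = formal_sum (\<lambda>n. const_uw [:1 / fact n:] * F ^ n) UNIV"

text \<open>
  The quantities \<open>\<alpha>\<^sub>1\<close>, \<open>\<alpha>\<^sub>2\<close>, \<open>\<gamma>\<^sub>1\<close>, \<open>\<gamma>\<^sub>2\<close> are not themselves
  power series, so they are taken in an algebraic closure of the fraction field; \<open>descend\<close>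
  regards elements of that closure which come from the series ring as series again.
\<close>
type_synonym series_closure = "series fract alg_closure"

definition to_closure :: "series \<Rightarrow> series_closure" where
  "to_closure F = to_ac (Fraction_Field.Fract F 1)"

definition descend :: "series_closure \<Rightarrow> series" where
  "descend x = (THE F. to_closure F = x)"

lemma inj_to_closure: "inj to_closure"
  by (auto simp: inj_def to_closure_def eq_fract)

lemma descend_to_closure: "descend (to_closure F) = F"
  unfolding descend_def using inj_to_closure by (auto simp: inj_def)

end

theory Submission
  imports Defs
begin

text \<open>
  An index of equal depth and height is one with all parts at least 2. Summing over such indices,
  the parts that are merged onto one summation variable \<open>m\<close> contribute a geometric series, so
  the generating function is the product over \<open>m\<close> of
  \<open>(1 + (1 - r) x) / (1 - r x)\<close> with \<open>x = w\<^sup>2 / (m (m - u))\<close>, which is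
  \<open>(1 - \<gamma>\<^sub>1/m) (1 - \<gamma>\<^sub>2/m) / ((1 - \<alpha>\<^sub>1/m) (1 - \<alpha>\<^sub>2/m))\<close>.
  Its logarithm is the exponent on the right, the terms with \<open>n = 1\<close> cancelling.
  To avoid infinite products, the identity is put in the form \<open>H' = \<Phi>' H\<close> (derivative in
  \<open>w\<close>), which is proved for \<open>m \<le> L\<close> by induction on \<open>L\<close>, survives the coefficientwise limit
  \<open>L \<rightarrow> \<infinity>\<close>, and has a unique solution with constant term 1.
\<close>

section \<open>Generating series over indices with all parts at least 2\<close>

definition big_part_indices :: "nat \<Rightarrow> nat \<Rightarrow> nat list set" where
  "big_part_indices n i = {ks. length ks = n \<and> (\<forall>k\<in>set ks. 2 \<le> k) \<and> sum_list ks = i + 2 * n}"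

lemma smult_sum_right: "smult c (\<Sum>x\<in>A. f x) = (\<Sum>x\<in>A. smult c (f x))"
  by (induction A rule: infinite_finite_induct) (simp_all add: smult_add_right)

text \<open>An index contributes to u^(weight - 2 depth) w^(2 depth); the shift in
  \<open>big_part_indices\<close> makes \<open>i\<close> the exponent of u.\<close>

definition big_part_series :: "(nat list \<Rightarrow> real poly) \<Rightarrow> series" where
  "big_part_series g = Abs_fps (\<lambda>j. if even j
     then Abs_fps (\<lambda>i. \<Sum>ks\<in>big_part_indices (j div 2) i. g ks) else 0)"

definition part_weight :: "real \<Rightarrow> real poly fps" where
  "part_weight z = Abs_fps (\<lambda>i. [:z ^ (i + 2):])"

text \<open>With \<open>z = 1/m\<close>, \<open>part_series z\<close> is \<open>w\<^sup>2 / (m (m - u))\<close>.\<close>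
definition part_series :: "real \<Rightarrow> series" where
  "part_series z = fps_const (part_weight z) * fps_X ^ 2"

lemma finite_big_part_indices [simp]: "finite (big_part_indices n i)"
proof (rule finite_subset)
  show "big_part_indices n i \<subseteq> {ks. set ks \<subseteq> {..i + 2 * n} \<and> length ks = n}"
    using member_le_sum_list by (fastforce simp: big_part_indices_def)
qed (simp add: finite_lists_length_eq)

lemma big_part_indices_0: "big_part_indices 0 i = (if i = 0 then {[]} else {})"
  by (auto simp: big_part_indices_def)

lemma sum_list_ge_twice_length: "(\<And>k. k \<in> set ks \<Longrightarrow> 2 \<le> k) \<Longrightarrow> 2 * length ks \<le> sum_list (ks :: nat list)"
proof (induction ks)
  case (Cons k ks)
  from Cons.prems[of k] have "2 \<le> k" by simp
  moreover have "2 * length ks \<le> sum_list ks" using Cons by simp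
  ultimately show ?case by simp
qed simp

lemma sum_big_part_indices_Suc:
  fixes g :: "nat list \<Rightarrow> 'a::comm_monoid_add"
  shows "(\<Sum>ks\<in>big_part_indices (Suc n) i. g ks) =
    (\<Sum>j=0..i. \<Sum>ks\<in>big_part_indices n (i - j). g ((j + 2) # ks))"
proof -
  have "(\<Sum>ks\<in>big_part_indices (Suc n) i. g ks) =
    (\<Sum>(j, ks)\<in>Sigma {0..i} (\<lambda>j. big_part_indices n (i - j)). g ((j + 2) # ks))"
  proof (rule sum.reindex_bij_witness[of _ "\<lambda>(j, ks). (j + 2) # ks" "\<lambda>ks. (hd ks - 2, tl ks)"])
    fix ks assume ks: "ks \<in> big_part_indices (Suc n) i"
    then obtain k ks' where k: "ks = k # ks'" "2 \<le> k" "length ks' = n" "\<forall>k\<in>set ks'. 2 \<le> k"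
        "k + sum_list ks' = i + 2 * Suc n"
      by (auto simp: big_part_indices_def length_Suc_conv)
    \<comment> \<open>The tail already uses weight 2n, which forces \<open>k - 2 \<le> i\<close> and
      keeps the subtractions on naturals exact.\<close>
    have "2 * n \<le> sum_list ks'" using sum_list_ge_twice_length[of ks'] k by auto
    then show "(hd ks - 2, tl ks) \<in> Sigma {0..i} (\<lambda>j. big_part_indices n (i - j))"
      using k by (auto simp: big_part_indices_def)
    show "(case (hd ks - 2, tl ks) of (j, ks) \<Rightarrow> (j + 2) # ks) = ks"
      "(case (hd ks - 2, tl ks) of (j, ks) \<Rightarrow> g ((j + 2) # ks)) = g ks"
      using k by (simp_all flip: add_2_eq_Suc')
  qed (auto simp: big_part_indices_def)
  then show ?thesis by (simp add: sum.Sigma)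
qed

lemma big_part_series_diff:
  "big_part_series (\<lambda>ks. g ks - h ks) = big_part_series g - big_part_series h"
  by (auto intro!: fps_ext simp: big_part_series_def sum_subtractf)

lemma big_part_series_cmult:
  "big_part_series (\<lambda>ks. c * g ks) = const_uw c * big_part_series g"
  by (auto intro!: fps_ext simp: big_part_series_def sum_distrib_left const_uw_def)

lemma big_part_series_indicator_Nil:
  assumes "g [] = 1" "\<And>k ks. g (k # ks) = 0"
  shows "big_part_series g = 1"
proof (intro fps_ext)
  fix j i
  have *: "(\<Sum>ks\<in>big_part_indices (j div 2) i. g ks) = 0" if "even j" "j \<noteq> 0"
  proof (rule sum.neutral, intro ballI)
    fix ks assume "ks \<in> big_part_indices (j div 2) i"
    then have "ks \<noteq> []" using that by (auto simp: big_part_indices_def elim!: evenE)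
    then show "g ks = 0" using assms(2) by (cases ks) auto
  qed
  show "big_part_series g $ j $ i = 1 $ j $ i"
  proof (cases "j = 0")
    case False
    then show ?thesis using * by (auto simp: big_part_series_def)
  qed (auto simp: big_part_series_def big_part_indices_0 assms)
qed

text \<open>Detaching the first part k leaves a convolution in u, with factor z^k u^(k-2), and a
  shift by w^2. Summed over k >= 2 these factors form \<open>part_series z\<close>.\<close>

lemma big_part_series_Cons:
  assumes "g [] = 0" "\<And>k ks. g (k # ks) = smult (z ^ k) (h ks)"
  shows "big_part_series g = part_series z * big_part_series h"
proof (rule fps_ext)
  fix j
  have rhs: "(part_series z * big_part_series h) $ j =
      (if j < 2 then 0 else part_weight z * big_part_series h $ (j - 2))"
    by (simp add: part_series_def mult.assoc fps_X_power_mult_nth)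
  show "big_part_series g $ j = (part_series z * big_part_series h) $ j"
  proof (cases "even j \<and> j \<noteq> 0")
    case True
    then obtain n where n: "j = 2 * n" "n \<noteq> 0" by auto
    then obtain m where m: "j = 2 * Suc m" by (cases n) auto
    show ?thesis unfolding rhs
      using m by (auto intro!: fps_ext sum.cong simp: big_part_series_def sum_big_part_indices_Suc
          assms fps_mult_nth part_weight_def smult_sum_right simp del: sum.op_ivl_Suc)
  next
    case False
    then consider "j = 0" | "odd j" by blast
    then show ?thesis
    proof cases
      case 1
      then show ?thesis unfolding rhs
        by (auto intro!: fps_ext simp: big_part_series_def big_part_indices_0 assms)
    next
      case 2
      then have "j < 2 \<or> odd (j - 2)" by auto
      then show ?thesis unfolding rhs using 2 by (auto simp: big_part_series_def)
    qed
  qed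
qed

subsection \<open>Interpolation\<close>

text \<open>This is \<open>t_interp\<close> with \<open>t_value\<close> replaced by an arbitrary
  \<open>T\<close>, so that truncated values and their increments can be interpolated as
  well.\<close>

definition interpolate :: "(nat list \<Rightarrow> real) \<Rightarrow> nat list \<Rightarrow> real poly" where
  "interpolate T ks = (\<Sum>bs \<in> {bs :: bool list. length bs = length ks - 1}.
     Polynomial.monom (T (fill_boxes ks bs)) (length ks - length (fill_boxes ks bs)))"

lemma length_fill_boxes_le: "length (fill_boxes ks bs) \<le> length ks"
  by (induction ks bs rule: fill_boxes.induct) auto

lemma fill_boxes_eq_Nil_iff [simp]: "fill_boxes ks bs = [] \<longleftrightarrow> ks = []"
  by (induction ks bs rule: fill_boxes.induct) auto

lemma fill_boxes_Nil [simp]: "fill_boxes ks [] = ks"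
  by (cases ks) auto

lemma fill_boxes_ge:
  "(\<And>k. k \<in> set ks \<Longrightarrow> c \<le> k) \<Longrightarrow> k \<in> set (fill_boxes ks bs) \<Longrightarrow> c \<le> k"
proof (induction ks bs rule: fill_boxes.induct)
  case (1 k' k'' ks bs)
  have "c \<le> k' + k''" using "1.prems"(1)[of k'] by simp
  then show ?case using 1 by auto
qed auto

lemma finite_bool_lists [simp]: "finite {bs :: bool list. length bs = n}"
  using finite_lists_length_eq[of "UNIV :: bool set" n] by simp

lemma interpolate_Nil [simp]: "interpolate T [] = [:T []:]"
  by (simp add: interpolate_def monom_0)

lemma interpolate_singleton [simp]: "interpolate T [k] = [:T [k]:]"
  by (simp add: interpolate_def monom_0)

text \<open>Split on the first box: a plus sign lowers the depth by one and so costs a factor r,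
  which is \<open>pCons 0\<close>; a comma freezes \<open>k\<close> in front.\<close>

lemma interpolate_Cons_Cons:
  "interpolate T (k # k' # ks) =
     pCons 0 (interpolate T ((k + k') # ks)) + interpolate (\<lambda>p. T (k # p)) (k' # ks)"
proof -
  let ?B = "\<lambda>n. {bs :: bool list. length bs = n}"
  let ?n = "length ks"
  let ?f = "\<lambda>bs. Polynomial.monom (T (fill_boxes (k # k' # ks) bs))
     (length (k # k' # ks) - length (fill_boxes (k # k' # ks) bs))"
  have B: "?B (Suc ?n) = (#) True ` ?B ?n \<union> (#) False ` ?B ?n"
    by (auto simp: length_Suc_conv)
  have "interpolate T (k # k' # ks) = (\<Sum>bs\<in>?B (Suc ?n). ?f bs)"
    by (simp add: interpolate_def)
  also have "\<dots> = (\<Sum>bs\<in>?B ?n. ?f (True # bs)) + (\<Sum>bs\<in>?B ?n. ?f (False # bs))"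
    unfolding B by (subst sum.union_disjoint) (auto simp: sum.reindex)
  also have "(\<Sum>bs\<in>?B ?n. ?f (True # bs)) = pCons 0 (interpolate T ((k + k') # ks))"
  proof -
    have "?f (True # bs) = Polynomial.monom 1 1 *
        Polynomial.monom (T (fill_boxes ((k + k') # ks) bs))
          (length ((k + k') # ks) - length (fill_boxes ((k + k') # ks) bs))" for bs
      using length_fill_boxes_le[of "(k + k') # ks" bs] by (simp add: mult_monom Suc_diff_le)
    then have "(\<Sum>bs\<in>?B ?n. ?f (True # bs)) =
        Polynomial.monom 1 1 * interpolate T ((k + k') # ks)"
      by (simp add: interpolate_def sum_distrib_left)
    then show ?thesis by (simp add: monom_altdef)
  qed
  also have "(\<Sum>bs\<in>?B ?n. ?f (False # bs)) = interpolate (\<lambda>p. T (k # p)) (k' # ks)"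
    by (simp add: interpolate_def)
  finally show ?thesis .
qed

lemma interpolate_add: "interpolate (\<lambda>p. S p + T p) ks = interpolate S ks + interpolate T ks"
  by (simp add: interpolate_def flip: add_monom sum.distrib)

lemma interpolate_cmult: "interpolate (\<lambda>p. c * T p) ks = smult c (interpolate T ks)"
  by (simp add: interpolate_def smult_monom smult_sum_right)

lemma interpolate_cong_Cons:
  assumes "\<And>k p. S (k # p) = T (k # p)"
  shows "interpolate S (k # ks) = interpolate T (k # ks)"
  unfolding interpolate_def
proof (intro sum.cong refl)
  fix bs
  have "fill_boxes (k # ks) bs \<noteq> []" by simp
  then obtain k' p where "fill_boxes (k # ks) bs = k' # p" by (meson neq_Nil_conv)
  then show "monom (S (fill_boxes (k # ks) bs)) (dep (k # ks) - dep (fill_boxes (k # ks) bs)) =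
    monom (T (fill_boxes (k # ks) bs)) (dep (k # ks) - dep (fill_boxes (k # ks) bs))"
    using assms by simp
qed

text \<open>
  Increment of \<open>interpolate T\<close> when a new largest summation variable \<open>1 / z\<close> becomes available,
  divided by \<open>z\<close> to the first exponent.
\<close>
fun merged_tail :: "real \<Rightarrow> (nat list \<Rightarrow> real) \<Rightarrow> nat list \<Rightarrow> real poly" where
  "merged_tail z T [] = [:T []:]"
| "merged_tail z T (k # ks) = pCons 0 (smult (z ^ k) (merged_tail z T ks)) + interpolate T (k # ks)"

text \<open>A plus sign in the first box gives z^(k + k') and a factor r, and the merging goes on; a
  comma ends it and leaves z^k times an interpolated value of \<open>T\<close>. These are the two
  summands of \<open>merged_tail\<close>.\<close>

lemma interpolate_head_power:
  assumes "\<And>k p. S (k # p) = z ^ k * T p"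
  shows "interpolate S (k # ks) = smult (z ^ k) (merged_tail z T ks)"
proof (induction ks arbitrary: k)
  case Nil
  then show ?case by (simp add: assms)
next
  case (Cons k' ks)
  show ?case
    unfolding interpolate_Cons_Cons Cons assms interpolate_cmult
    by (simp add: power_add smult_add_right)
qed

text \<open>One new summation variable multiplies the generating function by (1 - (r-1) x) / (1 - r
  x), where x is \<open>part_series z\<close>. With Q the series of \<open>merged_tail\<close>, the
  relations F' = F + x Q and Q = F + r x Q make both F and F' multiples of Q.\<close>

lemma big_part_series_step:
  assumes "T [] = 1" "T' [] = 1" "\<And>k p. T' (k # p) = T (k # p) + z ^ k * T p"
  shows "(1 - var_r * part_series z) * big_part_series (interpolate T') =
    (1 - (var_r - 1) * part_series z) * big_part_series (interpolate T)"
proof -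
  let ?F = "big_part_series (interpolate T)" and ?F' = "big_part_series (interpolate T')"
  let ?Q = "big_part_series (merged_tail z T)"
  have inc: "interpolate T' (k # ks) - interpolate T (k # ks) = smult (z ^ k) (merged_tail z T ks)" for k ks
  proof -
    let ?S = "\<lambda>p. T' p - T p"
    have "interpolate T' (k # ks) = interpolate (\<lambda>p. T p + ?S p) (k # ks)" by simp
    then show ?thesis
      unfolding interpolate_add using assms by (simp add: interpolate_head_power)
  qed
  have "?F' - ?F = part_series z * ?Q"
    unfolding big_part_series_diff[symmetric]
    by (rule big_part_series_Cons) (auto simp: assms inc)
  moreover have "?Q - ?F = var_r * (part_series z * ?Q)"
  proof -
    let ?g = "\<lambda>ks. case ks of [] \<Rightarrow> 0 | k # ks \<Rightarrow> smult (z ^ k) (merged_tail z T ks)"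
    have "merged_tail z T ks - interpolate T ks = [:0, 1:] * ?g ks" for ks
      by (cases ks) auto
    then have "?Q - ?F = var_r * big_part_series ?g"
      unfolding big_part_series_diff[symmetric] by (simp only: big_part_series_cmult var_r_def)
    also have "big_part_series ?g = part_series z * ?Q"
      by (rule big_part_series_Cons) auto
    finally show ?thesis .
  qed
  ultimately have "?F = (1 - var_r * part_series z) * ?Q" "?F' = ?F + part_series z * ?Q"
    by (simp_all add: eq_diff_eq diff_eq_eq left_diff_distrib mult.assoc add.commute)
  then have "?F = (1 - var_r * part_series z) * ?Q" "?F' = (1 - (var_r - 1) * part_series z) * ?Q"
    by (simp_all add: left_diff_distrib mult.assoc)
  then show ?thesis by (simp only: mult.left_commute)
qed

subsection \<open>The exponent\<close>

text \<open>
  This is \<open>\<Sum>n. \<tau> n / n (\<alpha>\<^sub>1\<^sup>n + \<alpha>\<^sub>2\<^sup>n - \<gamma>\<^sub>1\<^sup>n - \<gamma>\<^sub>2\<^sup>n)\<close>, expanded by the explicit form of the power sums.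
  For \<open>j = 0\<close> the quotient by \<open>j div 2\<close> is junk, but the factor after it vanishes.
\<close>
definition log_series :: "(nat \<Rightarrow> real) \<Rightarrow> series" where
  "log_series \<tau> = Abs_fps (\<lambda>j. if even j then Abs_fps (\<lambda>i.
     smult (\<tau> (i + j) * real ((i + j div 2 - 1) choose (j div 2 - 1)) / real (j div 2))
       ([:0, 1:] ^ (j div 2) - ([:0, 1:] - 1) ^ (j div 2))) else 0)"

lemma log_series_add: "log_series (\<lambda>n. \<sigma> n + \<tau> n) = log_series \<sigma> + log_series \<tau>"
  by (auto intro!: fps_ext simp: log_series_def ring_distribs add_divide_distrib smult_add_left)

lemma log_series_zero [simp]: "log_series (\<lambda>_. 0) = 0"
  by (auto intro!: fps_ext simp: log_series_def)

text \<open>The hockey-stick identity.\<close>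

lemma sum_choose_row_shift: "(\<Sum>j=0..i. (j + l) choose l) = (i + Suc l) choose Suc l"
  by (induction i) auto

text \<open>Negative binomial expansion of (z^2 / (1 - z u))^(l+1).\<close>

lemma part_weight_power_nth:
  "(part_weight z ^ Suc l) $ i = [:real ((i + l) choose l) * z ^ (i + 2 * Suc l):]"
proof (induction l arbitrary: i)
  case 0
  then show ?case by (simp add: part_weight_def)
next
  case (Suc l)
  have "(part_weight z ^ Suc (Suc l)) $ i =
      (\<Sum>j=0..i. (part_weight z ^ Suc l) $ j * part_weight z $ (i - j))"
    by (subst power_Suc2) (rule fps_mult_nth)
  also have "\<dots> = (\<Sum>j=0..i. [:real ((j + l) choose l) * z ^ (i + 2 * Suc (Suc l)):])"
  proof (intro sum.cong refl)
    fix j assume "j \<in> {0..i}"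
    then have "z ^ (j + 2 * Suc l) * z ^ (i - j + 2) = z ^ (i + 2 * Suc (Suc l))"
      by (simp add: ac_simps flip: power_add)
    moreover have "part_weight z $ n = [:z ^ (n + 2):]" for n
      by (simp add: part_weight_def)
    moreover have "[:x * p:] * [:q:] = [:x * (p * q):]" for x p q :: real
      by simp
    ultimately show "(part_weight z ^ Suc l) $ j * part_weight z $ (i - j) =
        [:real ((j + l) choose l) * z ^ (i + 2 * Suc (Suc l)):]"
      by (simp only: Suc.IH)
  qed
  also have "\<dots> = [:real (\<Sum>j=0..i. (j + l) choose l) * z ^ (i + 2 * Suc (Suc l)):]"
    by (simp only: of_nat_sum sum_distrib_right sum_to_poly)
  finally show ?case unfolding sum_choose_row_shift by simp
qed

text \<open>The inverse of 1 - c x for x = \<open>part_series z\<close>, expanded in powers of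
  w.\<close>

definition geometric_part_series :: "real poly \<Rightarrow> real \<Rightarrow> series" where
  "geometric_part_series c z =
     Abs_fps (\<lambda>j. if even j then (fps_const c * part_weight z) ^ (j div 2) else 0)"

lemma geometric_part_series_mult:
  "(1 - const_uw c * part_series z) * geometric_part_series c z = 1"
proof (rule fps_ext)
  fix j
  have *: "const_uw c * part_series z * geometric_part_series c z =
      fps_const (fps_const c * part_weight z) * (fps_X ^ 2 * geometric_part_series c z)"
    by (simp add: const_uw_def part_series_def mult.assoc flip: fps_const_mult)
  show "((1 - const_uw c * part_series z) * geometric_part_series c z) $ j = 1 $ j"
  proof (cases "even j \<and> j \<noteq> 0")
    case True
    then obtain n where "j = 2 * n" "n \<noteq> 0" by auto
    then obtain m where "j = 2 * Suc m" by (cases n) auto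
    then show ?thesis
      unfolding left_diff_distrib * fps_sub_nth fps_mult_left_const_nth fps_X_power_mult_nth
      by (simp add: geometric_part_series_def)
  next
    case False
    then show ?thesis
      unfolding left_diff_distrib * fps_sub_nth fps_mult_left_const_nth fps_X_power_mult_nth
      by (auto simp: geometric_part_series_def)
  qed
qed

lemma of_nat_mult_smult: "of_nat n * smult v p = smult (of_nat n * v) p"
  by (simp add: of_nat_poly mult.commute)

lemma two_mult_const_poly: "2 * (p * [:v:]) = smult (2 * v) (p :: real poly)"
  by (simp add: numeral_poly mult.commute)

text \<open>For \<tau>(n) = z^n, \<open>log_series\<close> is the sum of (r^l - (r-1)^l) x^l / l
  over l >= 1, with x = \<open>part_series z\<close>. The operator w d/dw multiplies the term in
  w^(2l) by 2l, which cancels 1/l and leaves geometric series.\<close>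

lemma X_mult_deriv_log_series:
  "fps_X * fps_deriv (log_series (\<lambda>n. z ^ n)) =
    2 * (geometric_part_series [:0, 1:] z - geometric_part_series ([:0, 1:] - 1) z)"
proof (rule fps_ext)
  fix j
  show "(fps_X * fps_deriv (log_series (\<lambda>n. z ^ n))) $ j =
    (2 * (geometric_part_series [:0, 1:] z - geometric_part_series ([:0, 1:] - 1) z)) $ j"
  proof (cases "even j \<and> j \<noteq> 0")
    case True
    then obtain n where "j = 2 * n" "n \<noteq> 0" by auto
    then obtain l where l: "j = 2 * Suc l" by (cases n) auto
    show ?thesis
    proof (rule fps_ext)
      fix i
      let ?c = "[:0, 1:] ^ Suc l - ([:0, 1:] - 1) ^ Suc l :: real poly"
      have "(fps_X * fps_deriv (log_series (\<lambda>n. z ^ n))) $ j $ i =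
          of_nat (2 * Suc l) * smult (z ^ (i + 2 * Suc l) * real ((i + l) choose l) / real (Suc l)) ?c"
        using l by (simp add: log_series_def fps_mult_of_nat_nth del: of_nat_Suc power_Suc)
      also have "\<dots> = 2 * (?c * (part_weight z ^ Suc l) $ i)"
      proof -
        have "real (2 * Suc l) * (x * y / real (Suc l)) = 2 * (y * x)" for x y :: real
          by (simp add: field_simps)
        then have "of_nat (2 * Suc l) * smult (x * y / real (Suc l)) ?c = 2 * (?c * [:y * x:])" for x y
          unfolding of_nat_mult_smult two_mult_const_poly by simp
        then show ?thesis unfolding part_weight_power_nth .
      qed
      also have "\<dots> = (2 * (geometric_part_series [:0, 1:] z - geometric_part_series ([:0, 1:] - 1) z)) $ j $ i"
        using l by (simp add: geometric_part_series_def power_mult_distrib fps_const_power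
            numeral_fps_const left_diff_distrib del: power_Suc)
      finally show "(fps_X * fps_deriv (log_series (\<lambda>n. z ^ n))) $ j $ i = \<dots>" .
    qed
  next
    case False
    then show ?thesis
      by (cases "j = 0") (auto simp: log_series_def geometric_part_series_def numeral_fps_const)
  qed
qed

lemma var_r_minus_1: "const_uw ([:0, 1:] - 1) = var_r - 1"
  by (simp add: var_r_def const_uw_def flip: fps_const_sub)

lemma mult_diff_shuffle:
  "A * B * (2 * (G - H)) = 2 * (B * (A * G) - A * (B * H) :: 'a::comm_ring_1)"
  by (simp add: algebra_simps)

lemma deriv_log_series:
  "(1 - var_r * part_series z) * (1 - (var_r - 1) * part_series z) *
     fps_deriv (log_series (\<lambda>n. z ^ n)) = fps_deriv (part_series z)"
proof -
  let ?A = "1 - var_r * part_series z" and ?B = "1 - (var_r - 1) * part_series z"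
  let ?G = "geometric_part_series [:0, 1:] z" and ?H = "geometric_part_series ([:0, 1:] - 1) z"
  have G: "?A * ?G = 1"
    using geometric_part_series_mult[of "[:0, 1:]" z] by (simp only: var_r_def)
  have H: "?B * ?H = 1"
    using geometric_part_series_mult[of "[:0, 1:] - 1" z] by (simp only: var_r_minus_1)
  have "fps_X * (?A * ?B * fps_deriv (log_series (\<lambda>n. z ^ n))) = ?A * ?B * (2 * (?G - ?H))"
    unfolding X_mult_deriv_log_series[symmetric] by (simp only: mult.left_commute)
  also have "\<dots> = 2 * (?B * (?A * ?G) - ?A * (?B * ?H))"
    using mult_diff_shuffle[of ?A ?B ?G ?H] .
  \<comment> \<open>By \<open>G\<close> and \<open>H\<close> the bracket is \<open>?B - ?A\<close>,
    which is x.\<close>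
  also have "\<dots> = 2 * part_series z"
    unfolding G H by (simp add: left_diff_distrib)
  \<comment> \<open>Euler's relation: x is homogeneous of degree 2 in w.\<close>
  also have "\<dots> = fps_X * fps_deriv (part_series z)"
    by (simp add: part_series_def power2_eq_square mult_ac)
  finally show ?thesis by simp
qed

lemma log_deriv_cancel:
  fixes A :: "'a::comm_ring_1"
  assumes "A * dG + dA * G = B * (D * F) + dB * F" "A * G = B * F" "A * B * E = dB * A - dA * B"
  shows "A * B * dG = A * B * ((D + E) * G)"
proof -
  have "A * B * dG = B * (A * dG + dA * G) - dA * B * G"
    by (simp add: algebra_simps)
  also have "\<dots> = (B * D + dB) * (B * F) - dA * B * G"
    unfolding assms(1) by (simp add: algebra_simps)
  also have "\<dots> = A * B * D * G + (dB * A - dA * B) * G"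
    unfolding assms(2)[symmetric] by (simp add: algebra_simps)
  also have "\<dots> = A * B * ((D + E) * G)"
    unfolding assms(3)[symmetric] by (simp add: algebra_simps)
  finally show ?thesis .
qed

text \<open>Here F' is a second series, not a derivative. From F' = (B/A) F the logarithmic
  derivatives add, and \<open>E\<close> is that of B/A. Multiplying through by A B avoids
  quotients.\<close>

lemma log_deriv_step:
  fixes A B :: "'a::idom fps"
  assumes step: "A * F' = B * F" and F: "fps_deriv F = D * F"
    and E: "A * B * E = fps_deriv B * A - fps_deriv A * B" and nz: "A * B \<noteq> 0"
  shows "fps_deriv F' = (D + E) * F'"
proof -
  have "A * fps_deriv F' + fps_deriv A * F' = B * (D * F) + fps_deriv B * F"
    using arg_cong[OF step, of fps_deriv] F by simp
  then have "A * B * fps_deriv F' = A * B * ((D + E) * F')"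
    using step E by (rule log_deriv_cancel)
  then show ?thesis using nz by simp
qed

lemma part_series_factor_nonzero: "1 - c * part_series z \<noteq> 0"
proof
  assume "1 - c * part_series z = 0"
  then have "(1 - c * part_series z) $ 0 = 0" by simp
  then show False by (simp add: part_series_def)
qed

lemma big_part_series_deriv_step:
  assumes "T [] = 1" "T' [] = 1" "\<And>k p. T' (k # p) = T (k # p) + z ^ k * T p"
    and "fps_deriv (big_part_series (interpolate T)) = D * big_part_series (interpolate T)"
  shows "fps_deriv (big_part_series (interpolate T')) =
    (D + fps_deriv (log_series (\<lambda>n. z ^ n))) * big_part_series (interpolate T')"
proof (rule log_deriv_step[OF big_part_series_step[OF assms(1-3)] assms(4)])
  show "(1 - var_r * part_series z) * (1 - (var_r - 1) * part_series z) *
      fps_deriv (log_series (\<lambda>n. z ^ n)) =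
    fps_deriv (1 - (var_r - 1) * part_series z) * (1 - var_r * part_series z) -
    fps_deriv (1 - var_r * part_series z) * (1 - (var_r - 1) * part_series z)"
    \<comment> \<open>With A = 1 - r x and B = 1 - (r-1) x, the terms in x dx cancel and dB A - dA B
      = dx.\<close>
    unfolding deriv_log_series by (simp add: var_r_def const_uw_def algebra_simps)
qed (metis mult_eq_0_iff part_series_factor_nonzero)

subsection \<open>Truncated values\<close>

definition t_term :: "nat list \<Rightarrow> nat list \<Rightarrow> real" where
  "t_term ks ms = 1 / (\<Prod>i<length ks. real (ms ! i) ^ (ks ! i))"

text \<open>The free predicate lets \<open>t_value\<close> and its truncations share one kind of
  summation range.\<close>

definition decreasing_lists :: "(nat \<Rightarrow> bool) \<Rightarrow> nat \<Rightarrow> nat list set" where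
  "decreasing_lists P n = {ms. length ms = n \<and> sorted_wrt (>) ms \<and> (\<forall>m\<in>set ms. 0 < m \<and> P m)}"

definition t_trunc :: "(nat \<Rightarrow> bool) \<Rightarrow> nat \<Rightarrow> nat list \<Rightarrow> real" where
  "t_trunc P L ks = (\<Sum>ms\<in>decreasing_lists (\<lambda>m. m \<le> L \<and> P m) (length ks). t_term ks ms)"

lemma t_value_eq_infsum:
  "t_value N a ks = (\<Sum>\<^sub>\<infinity>ms\<in>decreasing_lists (\<lambda>m. [m = a] (mod N)) (length ks). t_term ks ms)"
  by (simp add: t_value_def decreasing_lists_def t_term_def)

lemma decreasing_lists_0: "decreasing_lists P 0 = {[]}"
  by (auto simp: decreasing_lists_def)

lemma finite_decreasing_lists [simp]: "finite (decreasing_lists (\<lambda>m. m \<le> L \<and> P m) n)"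
  by (rule finite_subset[OF _ finite_lists_length_eq[of "{..L}" n]])
    (auto simp: decreasing_lists_def)

lemma t_term_Nil [simp]: "t_term [] ms = 1"
  by (simp add: t_term_def)

lemma t_term_Cons [simp]: "t_term (k # ks) (m # ms) = (1 / real m) ^ k * t_term ks ms"
  by (simp add: t_term_def prod.lessThan_Suc_shift power_one_over del: prod.lessThan_Suc)

lemma t_term_nonneg: "0 \<le> t_term ks ms"
  by (simp add: t_term_def prod_nonneg)

lemma t_trunc_Nil [simp]: "t_trunc P L [] = 1"
  by (simp add: t_trunc_def decreasing_lists_0)

lemma t_trunc_0 [simp]: "t_trunc P 0 (k # ks) = 0"
  by (auto simp: t_trunc_def decreasing_lists_def length_Suc_conv intro!: sum.neutral)

lemma t_trunc_nonneg: "0 \<le> t_trunc P L ks"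
  by (simp add: t_trunc_def sum_nonneg t_term_nonneg)

text \<open>Split on whether the largest entry is \<open>Suc L\<close>. The result is the recursion
  assumed in \<open>big_part_series_step\<close>, with z = 1/(L+1).\<close>

lemma t_trunc_Suc:
  "t_trunc P (Suc L) (k # ks) = t_trunc P L (k # ks) +
     (if P (Suc L) then (1 / real (Suc L)) ^ k * t_trunc P L ks else 0)"
proof -
  let ?D = "\<lambda>L. decreasing_lists (\<lambda>m. m \<le> L \<and> P m)"
  let ?n = "length ks"
  let ?new = "if P (Suc L) then (#) (Suc L) ` ?D L ?n else {}"
  have D: "?D (Suc L) (Suc ?n) = ?D L (Suc ?n) \<union> ?new"
  proof (intro Set.set_eqI iffI)
    fix ms assume "ms \<in> ?D (Suc L) (Suc ?n)"
    then show "ms \<in> ?D L (Suc ?n) \<union> ?new"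
      by (cases ms) (fastforce simp: decreasing_lists_def le_Suc_eq)+
  next
    fix ms assume "ms \<in> ?D L (Suc ?n) \<union> ?new"
    then show "ms \<in> ?D (Suc L) (Suc ?n)"
      by (fastforce simp: decreasing_lists_def split: if_splits)
  qed
  have "?D L (Suc ?n) \<inter> ?new = {}"
    by (auto simp: decreasing_lists_def)
  then have "t_trunc P (Suc L) (k # ks) = t_trunc P L (k # ks) + sum (t_term (k # ks)) ?new"
    unfolding t_trunc_def list.size(4) add_0_right add_Suc_right One_nat_def D
    by (intro sum.union_disjoint) auto
  then show ?thesis
    by (simp add: t_trunc_def sum.reindex sum_distrib_left del: of_nat_Suc)
qed

text \<open>Each summation variable costs at most the sum of 1/m^2, which is below 2.\<close>

lemma t_trunc_le:
  assumes "\<And>k. k \<in> set ks \<Longrightarrow> 2 \<le> k"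
  shows "t_trunc P L ks \<le> 2 ^ length ks"
  using assms
proof (induction ks arbitrary: L)
  case Nil
  then show ?case by simp
next
  case (Cons k ks)
  have IH: "t_trunc P L ks \<le> 2 ^ length ks" for L
    using Cons by simp
  have k: "2 \<le> k" using Cons.prems by simp
  \<comment> \<open>The factor 2 - 2/(L+1) vanishes at L = 0, and its increments 2/m - 2/(m+1)
    dominate 1/m^2.\<close>
  have "t_trunc P L (k # ks) \<le> (2 - 2 / real (Suc L)) * 2 ^ length ks"
  proof (induction L)
    case (Suc L)
    have "(1 / real (Suc L)) ^ k \<le> (1 / real (Suc L)) ^ 2"
      using k by (intro power_decreasing) auto
    also have "\<dots> \<le> 2 / real (Suc L) - 2 / real (Suc (Suc L))"
    proof -
      have "(1 / x) ^ 2 = 2 / (x * (x + x))" "2 / x - 2 / (x + 1) = 2 / (x * (x + 1))"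
        if "1 \<le> x" for x :: real
        using that by (simp_all add: power2_eq_square diff_frac_eq distrib_left)
      moreover have "2 / (x * (x + x)) \<le> 2 / (x * (x + 1))" if "1 \<le> x" for x :: real
        using that by (intro divide_left_mono mult_left_mono mult_pos_pos) auto
      ultimately have "(1 / x) ^ 2 \<le> 2 / x - 2 / (x + 1)" if "1 \<le> x" for x :: real
        using that by simp
      from this[of "real (Suc L)"] show ?thesis by (simp add: add.commute)
    qed
    finally have le: "(1 / real (Suc L)) ^ k \<le> 2 / real (Suc L) - 2 / real (Suc (Suc L))" .
    have nonneg: "0 \<le> 2 / real (Suc L) - 2 / real (Suc (Suc L))"
      by (rule order.trans[OF _ le]) simp
    have "(1 / real (Suc L)) ^ k * t_trunc P L ks \<le>
        (2 / real (Suc L) - 2 / real (Suc (Suc L))) * 2 ^ length ks"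
      by (rule mult_mono[OF le IH nonneg t_trunc_nonneg])
    moreover have "0 \<le> (2 / real (Suc L) - 2 / real (Suc (Suc L))) * 2 ^ length ks"
      using nonneg by simp
    ultimately show ?case using Suc
      unfolding t_trunc_Suc by (auto simp: left_diff_distrib)
  qed simp
  also have "\<dots> \<le> 2 * 2 ^ length ks"
    by (intro mult_right_mono) auto
  finally show ?case by simp
qed

text \<open>The terms are nonnegative with bounded finite sums, hence summable. The truncated ranges
  increase and absorb every finite subset, so the truncated sums converge to the infinite
  sum.\<close>

lemma t_trunc_tendsto_t_value:
  assumes "\<And>k. k \<in> set ks \<Longrightarrow> 2 \<le> k"
  shows "(\<lambda>L. t_trunc (\<lambda>m. [m = a] (mod N)) L ks) \<longlonglongrightarrow> t_value N a ks"
proof -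
  let ?P = "\<lambda>m. [m = a] (mod N)"
  let ?A = "decreasing_lists ?P (length ks)"
  let ?D = "\<lambda>L. decreasing_lists (\<lambda>m. m \<le> L \<and> ?P m) (length ks)"
  have D_mono: "?D L \<subseteq> ?D L'" if "L \<le> L'" for L L'
    using that by (auto simp: decreasing_lists_def)
  have D_sub: "?D L \<subseteq> ?A" for L
    by (auto simp: decreasing_lists_def)
  have exhaust: "\<exists>L. F \<subseteq> ?D L" if "finite F" "F \<subseteq> ?A" for F
  proof
    have "m \<le> (\<Sum>ms\<in>F. sum_list ms)" if "ms \<in> F" "m \<in> set ms" for m ms
      using member_le_sum_list[OF that(2)] member_le_sum[OF that(1), of sum_list] \<open>finite F\<close>
      by fastforce
    then show "F \<subseteq> ?D (\<Sum>ms\<in>F. sum_list ms)"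
      using that by (fastforce simp: decreasing_lists_def)
  qed
  have "bdd_above (sum (t_term ks) ` {F. F \<subseteq> ?A \<and> finite F})"
  proof (intro bdd_aboveI2)
    fix F assume "F \<in> {F. F \<subseteq> ?A \<and> finite F}"
    then obtain L where "F \<subseteq> ?D L" using exhaust by blast
    then have "sum (t_term ks) F \<le> t_trunc ?P L ks"
      unfolding t_trunc_def by (intro sum_mono2) (auto simp: t_term_nonneg)
    also have "\<dots> \<le> 2 ^ length ks"
      using assms by (rule t_trunc_le)
    finally show "sum (t_term ks) F \<le> 2 ^ length ks" .
  qed
  then have "t_term ks summable_on ?A"
    by (intro nonneg_bdd_above_summable_on t_term_nonneg)
  then have "(sum (t_term ks) \<longlongrightarrow> t_value N a ks) (finite_subsets_at_top ?A)"
    unfolding t_value_eq_infsum using has_sum_infsum has_sum_def by blast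
  moreover have "filterlim ?D (finite_subsets_at_top ?A) sequentially"
    unfolding filterlim_finite_subsets_at_top
  proof safe
    fix F assume F: "finite F" "F \<subseteq> ?A"
    then obtain L where "F \<subseteq> ?D L" using exhaust by blast
    then have "\<forall>L'\<ge>L. F \<subseteq> ?D L'" using D_mono by blast
    then show "\<forall>\<^sub>F L in sequentially. finite (?D L) \<and> F \<subseteq> ?D L \<and> ?D L \<subseteq> ?A"
      unfolding eventually_sequentially using D_sub by (intro exI[of _ L]) auto
  qed
  ultimately show ?thesis
    unfolding t_trunc_def by (rule filterlim_compose)
qed

lemma t_value_Nil [simp]: "t_value N a [] = 1"
  by (simp add: t_value_eq_infsum decreasing_lists_0)

section \<open>Passage to the limit, coefficient by coefficient\<close>

text \<open>Convergence in the reals of the coefficient of each monomial in r, u and w. Each such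
  coefficient of a product or a derivative depends on finitely many coefficients, so both operations
  are continuous.\<close>

definition coeff_tendsto :: "(nat \<Rightarrow> series) \<Rightarrow> series \<Rightarrow> bool" where
  "coeff_tendsto F G \<longleftrightarrow>
     (\<forall>i j l. (\<lambda>L. coeff (coeff_uw (F L) i j) l) \<longlonglongrightarrow> coeff (coeff_uw G i j) l)"

lemma coeff_tendsto_unique:
  assumes "coeff_tendsto F G" "coeff_tendsto F H"
  shows "G = H"
proof (intro fps_ext poly_eqI)
  fix i j l
  show "coeff (G $ j $ i) l = coeff (H $ j $ i) l"
    using assms LIMSEQ_unique unfolding coeff_tendsto_def coeff_uw_def by blast
qed

lemma coeff_tendsto_mult:
  assumes "coeff_tendsto F G" "coeff_tendsto F' G'"
  shows "coeff_tendsto (\<lambda>L. F L * F' L) (G * G')"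
  using assms unfolding coeff_tendsto_def coeff_uw_def
  by (auto simp: fps_mult_nth fps_sum_nth coeff_sum coeff_mult intro!: tendsto_intros)

lemma coeff_tendsto_deriv:
  assumes "coeff_tendsto F G"
  shows "coeff_tendsto (\<lambda>L. fps_deriv (F L)) (fps_deriv G)"
proof -
  have "coeff (fps_deriv F $ j $ i) l = of_nat (Suc j) * coeff (F $ Suc j $ i) l" for F :: series and i j l
    by (simp add: fps_mult_of_nat_nth of_nat_poly del: of_nat_Suc)
  then show ?thesis using assms unfolding coeff_tendsto_def coeff_uw_def
    by (auto intro!: tendsto_intros simp del: fps_deriv_nth)
qed

text \<open>Each coefficient involves finitely many indices, and filling boxes keeps all parts at
  least 2, where convergence is assumed.\<close>

lemma coeff_tendsto_big_part_series:
  assumes "\<And>ks. (\<And>k. k \<in> set ks \<Longrightarrow> 2 \<le> k) \<Longrightarrow> (\<lambda>L. T L ks) \<longlonglongrightarrow> T' ks"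
  shows "coeff_tendsto (\<lambda>L. big_part_series (interpolate (T L))) (big_part_series (interpolate T'))"
proof -
  have "(\<lambda>L. coeff (interpolate (T L) ks) l) \<longlonglongrightarrow> coeff (interpolate T' ks) l"
    if "\<And>k. k \<in> set ks \<Longrightarrow> 2 \<le> k" for ks l
  proof -
    have "(\<lambda>L. T L (fill_boxes ks bs)) \<longlonglongrightarrow> T' (fill_boxes ks bs)" for bs
      by (rule assms, rule fill_boxes_ge[OF that])
    then show ?thesis
      by (auto simp: interpolate_def coeff_sum intro!: tendsto_sum)
  qed
  then show ?thesis
    by (auto simp: coeff_tendsto_def coeff_uw_def big_part_series_def coeff_sum
        big_part_indices_def intro!: tendsto_sum)
qed

lemma coeff_tendsto_log_series:
  assumes "\<And>n. 2 \<le> n \<Longrightarrow> (\<lambda>L. \<tau> L n) \<longlonglongrightarrow> \<tau>' n"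
  shows "coeff_tendsto (\<lambda>L. log_series (\<tau> L)) (log_series \<tau>')"
  unfolding coeff_tendsto_def
proof (intro allI)
  fix i j l
  show "(\<lambda>L. coeff (coeff_uw (log_series (\<tau> L)) i j) l) \<longlonglongrightarrow> coeff (coeff_uw (log_series \<tau>') i j) l"
  \<comment> \<open>For j = 0 the coefficient is zero whatever \<tau> is, so the possibly divergent
    value at n = 1 never enters.\<close>
  proof (cases "even j \<and> j \<noteq> 0")
    case True
    then have "2 \<le> i + j" by auto
    then show ?thesis
      using assms by (auto simp: coeff_uw_def log_series_def divide_inverse intro!: tendsto_intros)
  qed (auto simp: coeff_uw_def log_series_def)
qed

lemma deriv_big_part_series_t_trunc:
  "fps_deriv (big_part_series (interpolate (t_trunc P L))) =
     fps_deriv (log_series (\<lambda>n. t_trunc P L [n])) * big_part_series (interpolate (t_trunc P L))"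
proof (induction L)
  case 0
  have "interpolate (t_trunc P 0) (k # ks) = 0" for k ks
  proof -
    have "interpolate (t_trunc P 0) (k # ks) = interpolate (\<lambda>_. 0) (k # ks)"
      by (rule interpolate_cong_Cons) simp
    then show ?thesis by (simp add: interpolate_def)
  qed
  \<comment> \<open>With no summation variable available, only the empty index contributes.\<close>
  then have "big_part_series (interpolate (t_trunc P 0)) = 1"
    by (intro big_part_series_indicator_Nil) auto
  then show ?case by simp
next
  case (Suc L)
  show ?case
  proof (cases "P (Suc L)")
    case True
    have "fps_deriv (big_part_series (interpolate (t_trunc P (Suc L)))) =
        (fps_deriv (log_series (\<lambda>n. t_trunc P L [n])) +
         fps_deriv (log_series (\<lambda>n. (1 / real (Suc L)) ^ n))) *
        big_part_series (interpolate (t_trunc P (Suc L)))"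
      by (rule big_part_series_deriv_step[OF _ _ _ Suc.IH]) (simp_all add: t_trunc_Suc True)
    moreover have "log_series (\<lambda>n. t_trunc P (Suc L) [n]) =
        log_series (\<lambda>n. t_trunc P L [n]) + log_series (\<lambda>n. (1 / real (Suc L)) ^ n)"
      by (simp add: t_trunc_Suc True flip: log_series_add)
    ultimately show ?thesis by simp
  next
    case False
    have "t_trunc P (Suc L) ks = t_trunc P L ks" for ks
      by (cases ks) (simp_all add: t_trunc_Suc False)
    then have "t_trunc P (Suc L) = t_trunc P L" by blast
    then show ?thesis using Suc.IH by simp
  qed
qed

text \<open>Both sides are coefficientwise limits of one sequence, by the identity for truncated
  values.\<close>

lemma deriv_big_part_series_t_value:
  "fps_deriv (big_part_series (interpolate (t_value N a))) =
     fps_deriv (log_series (\<lambda>n. t_value N a [n])) * big_part_series (interpolate (t_value N a))"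
proof (rule coeff_tendsto_unique)
  let ?T = "t_trunc (\<lambda>m. [m = a] (mod N))"
  have H: "coeff_tendsto (\<lambda>L. big_part_series (interpolate (?T L)))
      (big_part_series (interpolate (t_value N a)))"
    by (intro coeff_tendsto_big_part_series t_trunc_tendsto_t_value)
  then show "coeff_tendsto (\<lambda>L. fps_deriv (big_part_series (interpolate (?T L))))
      (fps_deriv (big_part_series (interpolate (t_value N a))))"
    by (rule coeff_tendsto_deriv)
  have "coeff_tendsto (\<lambda>L. log_series (\<lambda>n. ?T L [n])) (log_series (\<lambda>n. t_value N a [n]))"
    by (intro coeff_tendsto_log_series t_trunc_tendsto_t_value) auto
  with H show "coeff_tendsto (\<lambda>L. fps_deriv (big_part_series (interpolate (?T L))))
      (fps_deriv (log_series (\<lambda>n. t_value N a [n])) * big_part_series (interpolate (t_value N a)))"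
    unfolding deriv_big_part_series_t_trunc by (intro coeff_tendsto_mult coeff_tendsto_deriv)
qed

subsection \<open>Formal sums and the exponential\<close>

lemma coeff_uw_const_mult [simp]: "coeff_uw (const_uw c * F) i j = c * coeff_uw F i j"
  by (simp add: coeff_uw_def const_uw_def)

lemma coeff_uw_diff [simp]: "coeff_uw (F - G) i j = coeff_uw F i j - coeff_uw G i j"
  by (simp add: coeff_uw_def)

lemma coeff_uw_1 [simp]: "coeff_uw 1 i j = (if i = 0 \<and> j = 0 then 1 else 0)"
  by (simp add: coeff_uw_def)

lemma coeff_uw_two_mult: "coeff_uw (2 * F) i j = 2 * coeff_uw F i j"
  by (simp add: coeff_uw_def numeral_fps_const)

lemma coeff_uw_var_u_mult:
  "coeff_uw (var_u * F) i j = (if i = 0 then 0 else coeff_uw F (i - 1) j)"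
  by (simp add: coeff_uw_def var_u_def)

lemma coeff_uw_var_w_power_mult:
  "coeff_uw (var_w ^ n * F) i j = (if j < n then 0 else coeff_uw F i (j - n))"
  by (simp add: coeff_uw_def var_w_def fps_X_power_mult_nth)

lemma coeff_uw_var_u_power: "coeff_uw (var_u ^ n) i j = (if i = n \<and> j = 0 then 1 else 0)"
  by (simp add: coeff_uw_def var_u_def fps_const_power)

lemma coeff_uw_monomial:
  "coeff_uw (const_uw c * var_u ^ a * var_w ^ b) i j = (if i = a \<and> j = b then c else 0)"
proof -
  have "const_uw c * var_u ^ a * var_w ^ b = const_uw c * (var_w ^ b * var_u ^ a)"
    by (simp only: mult_ac)
  then show ?thesis
    by (simp only: coeff_uw_const_mult) (auto simp: coeff_uw_var_w_power_mult coeff_uw_var_u_power)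
qed

lemma coeff_uw_big_part_series:
  "coeff_uw (big_part_series g) i j =
     (if even j then \<Sum>ks\<in>big_part_indices (j div 2) i. g ks else 0)"
  by (simp add: coeff_uw_def big_part_series_def)

lemma coeff_uw_log_series:
  "coeff_uw (log_series \<tau>) i j = (if even j then
     smult (\<tau> (i + j) * real ((i + j div 2 - 1) choose (j div 2 - 1)) / real (j div 2))
       ([:0, 1:] ^ (j div 2) - ([:0, 1:] - 1) ^ (j div 2)) else 0)"
  by (simp add: coeff_uw_def log_series_def)

text \<open>Any finite set containing the support may replace the support itself.\<close>

lemma has_formal_sumI:
  assumes "\<And>i j. finite (B i j)" "\<And>i j. B i j \<subseteq> A"
    and "\<And>i j x. x \<in> A \<Longrightarrow> x \<notin> B i j \<Longrightarrow> coeff_uw (f x) i j = 0"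
    and "\<And>i j. coeff_uw S i j = (\<Sum>x\<in>B i j. coeff_uw (f x) i j)"
  shows "has_formal_sum f A S"
  unfolding has_formal_sum_def
proof (intro allI conjI)
  fix i j
  have sub: "{x\<in>A. coeff_uw (f x) i j \<noteq> 0} \<subseteq> B i j" using assms(3) by blast
  then show "finite {x\<in>A. coeff_uw (f x) i j \<noteq> 0}" using assms(1) finite_subset by blast
  show "coeff_uw S i j = (\<Sum>x\<in>{x\<in>A. coeff_uw (f x) i j \<noteq> 0}. coeff_uw (f x) i j)"
    unfolding assms(4) using assms(1) assms(2)[of i j] sub by (intro sum.mono_neutral_right) auto
qed

text \<open>If \<open>F $ 0 = 0\<close>, then \<open>F ^ n\<close> has no terms below \<open>w\<^sup>n\<close>, so the cut at \<open>n \<le> j\<close> loses nothing.\<close>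
definition truncated_exp :: "series \<Rightarrow> series" where
  "truncated_exp F = Abs_fps (\<lambda>j. \<Sum>n\<le>j. fps_const [:1 / fact n:] * (F ^ n) $ j)"

lemma exp_uw_eq_truncated_exp:
  assumes "F $ 0 = 0"
  shows "exp_uw F = truncated_exp F"
  unfolding exp_uw_def
proof (rule formal_sum_eqI, rule has_formal_sumI[where B = "\<lambda>i j. {..j}"])
  fix i j n :: nat assume "n \<notin> {..j}"
  then have "(F ^ n) $ j = 0" using startsby_zero_power_prefix[OF assms] by auto
  then show "coeff_uw (const_uw [:1 / fact n:] * F ^ n) i j = 0"
    unfolding coeff_uw_const_mult by (simp add: coeff_uw_def)
qed (simp_all add: coeff_uw_def const_uw_def truncated_exp_def fps_sum_nth)

lemma const_fact_Suc:
  "fps_const [:1 / fact (Suc n):] * of_nat (Suc n) = (fps_const [:1 / fact n:] :: real poly fps)"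
proof -
  have "[:1 / fact (Suc n):] * of_nat (Suc n) = ([:1 / fact n:] :: real poly)"
    by (simp add: of_nat_poly del: of_nat_Suc)
  then show ?thesis by (simp flip: fps_of_nat fps_const_mult)
qed

lemma deriv_truncated_exp:
  assumes "F $ 0 = 0"
  shows "fps_deriv (truncated_exp F) = fps_deriv F * truncated_exp F"
proof (rule fps_ext)
  fix j
  let ?c = "\<lambda>n. fps_const [:1 / fact n:] :: real poly fps"
  \<comment> \<open>The cut may be raised to a common \<open>j\<close> for all a <= j, since the
    added terms vanish; the double sum below can then be interchanged.\<close>
  have extend: "truncated_exp F $ a = (\<Sum>n\<le>j. ?c n * (F ^ n) $ a)" if "a \<le> j" for a
    unfolding truncated_exp_def fps_nth_Abs_fps
    using that startsby_zero_power_prefix[OF assms]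
    by (intro sum.mono_neutral_left) auto
  have "fps_deriv (truncated_exp F) $ j = (\<Sum>n\<le>Suc j. ?c n * fps_deriv (F ^ n) $ j)"
    by (simp add: truncated_exp_def sum_distrib_left mult_ac del: sum.atMost_Suc of_nat_Suc)
  also have "\<dots> = (\<Sum>n\<le>j. ?c (Suc n) * fps_deriv (F ^ Suc n) $ j)"
    by (subst sum.atMost_Suc_shift) simp
  also have "\<dots> = (\<Sum>n\<le>j. ?c n * (fps_deriv F * F ^ n) $ j)"
  proof (intro sum.cong refl)
    fix n
    have "fps_deriv (F ^ Suc n) = of_nat (Suc n) * (fps_deriv F * F ^ n)"
      by (simp only: fps_deriv_power' diff_Suc_1) (simp only: mult_ac)
    then have "?c (Suc n) * fps_deriv (F ^ Suc n) $ j =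
        ?c (Suc n) * of_nat (Suc n) * (fps_deriv F * F ^ n) $ j"
      by (simp only: fps_mult_of_nat_nth mult.assoc)
    then show "?c (Suc n) * fps_deriv (F ^ Suc n) $ j = ?c n * (fps_deriv F * F ^ n) $ j"
      by (simp only: const_fact_Suc)
  qed
  also have "\<dots> = (\<Sum>n\<le>j. \<Sum>a=0..j. fps_deriv F $ a * (?c n * (F ^ n) $ (j - a)))"
    by (simp add: fps_mult_nth sum_distrib_left mult_ac del: fps_deriv_nth)
  also have "\<dots> = (\<Sum>a=0..j. fps_deriv F $ a * (\<Sum>n\<le>j. ?c n * (F ^ n) $ (j - a)))"
    unfolding sum_distrib_left by (rule sum.swap)
  also have "\<dots> = (\<Sum>a=0..j. fps_deriv F $ a * truncated_exp F $ (j - a))"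
    by (intro sum.cong refl arg_cong2[of _ _ _ _ "(*)"] extend[symmetric]) simp
  finally show "fps_deriv (truncated_exp F) $ j = (fps_deriv F * truncated_exp F) $ j"
    by (simp add: fps_mult_nth)
qed

text \<open>The equation determines coefficient m + 1 from the earlier ones, because m + 1 can be
  cancelled in characteristic 0.\<close>

lemma fps_linear_ode_unique:
  fixes F G :: "'a::{idom, semiring_char_0} fps"
  assumes "fps_deriv F = D * F" "fps_deriv G = D * G" "F $ 0 = G $ 0"
  shows "F = G"
proof (rule fps_ext)
  fix n
  show "F $ n = G $ n"
  proof (induction n rule: less_induct)
    case (less n)
    show ?case
    proof (cases n)
      case 0
      then show ?thesis using assms(3) by simp
    next
      case (Suc m)
      have "of_nat (Suc m) * F $ Suc m = (D * F) $ m"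
        unfolding assms(1)[symmetric] by simp
      also have "\<dots> = (D * G) $ m"
        unfolding fps_mult_nth using less.IH Suc by (intro sum.cong refl) auto
      also have "\<dots> = of_nat (Suc m) * G $ Suc m"
        unfolding assms(2)[symmetric] by simp
      finally show ?thesis using Suc by (simp del: of_nat_Suc)
    qed
  qed
qed

lemma log_series_nth_0: "log_series \<tau> $ 0 = 0"
  by (auto intro: fps_ext simp: log_series_def)

lemma big_part_series_t_value_eq_exp:
  "big_part_series (interpolate (t_value N a)) = exp_uw (log_series (\<lambda>n. t_value N a [n]))"
proof -
  have "big_part_series (interpolate (t_value N a)) =
      truncated_exp (log_series (\<lambda>n. t_value N a [n]))"
  proof (rule fps_linear_ode_unique[OF deriv_big_part_series_t_value])
    \<comment> \<open>At w^0 the left side keeps only the empty index and the right side only the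
      term n = 0, so both are 1.\<close>
    have "(1 :: real poly fps) $ i = (if i = 0 then 1 else 0)" for i by simp
    then show "big_part_series (interpolate (t_value N a)) $ 0 =
        truncated_exp (log_series (\<lambda>n. t_value N a [n])) $ 0"
      by (intro fps_ext) (simp add: big_part_series_def big_part_indices_0 truncated_exp_def)
  qed (simp add: deriv_truncated_exp log_series_nth_0)
  then show ?thesis by (simp add: exp_uw_eq_truncated_exp log_series_nth_0)
qed

text \<open>Height equal to depth forces every part to be at least 2, and a nonempty index of this
  kind is admissible.\<close>

lemma I0_full_height:
  assumes "1 \<le> n"
  shows "I0 (i + 2 * n) n n = big_part_indices n i"
proof -
  have *: "card {i. i < length ks \<and> 2 \<le> ks ! i} = length ks \<longleftrightarrow> (\<forall>k\<in>set ks. 2 \<le> k)" for ks :: "nat list"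
  proof
    assume "card {i. i < length ks \<and> 2 \<le> ks ! i} = length ks"
    then have "{i. i < length ks \<and> 2 \<le> ks ! i} = {..<length ks}"
      by (intro card_subset_eq) auto
    then have "\<forall>i<length ks. 2 \<le> ks ! i" by blast
    then show "\<forall>k\<in>set ks. 2 \<le> k" by (simp add: all_set_conv_all_nth)
  next
    assume "\<forall>k\<in>set ks. 2 \<le> k"
    then have "{i. i < length ks \<and> 2 \<le> ks ! i} = {..<length ks}" by auto
    then show "card {i. i < length ks \<and> 2 \<le> ks ! i} = length ks" by simp
  qed
  have "hd ks \<in> set ks" if "length ks = n" for ks :: "nat list"
    using that assms by (intro hd_in_set) auto
  then show ?thesis
    using assms * by (fastforce simp: I0_def big_part_indices_def admissible_def is_index_def
        weight_def height_def)
qed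

lemma formal_sum_X0:
  "1 + formal_sum (\<lambda>(k, n). const_uw (X0 N a k n n) * var_u ^ (k - 2 * n) * var_w ^ (2 * n))
     {(k, n). k \<ge> 2 * n \<and> n \<ge> 1} = big_part_series (interpolate (t_value N a))"
proof -
  let ?f = "\<lambda>(k, n). const_uw (X0 N a k n n) * var_u ^ (k - 2 * n) * var_w ^ (2 * n)"
  let ?A = "{(k, n). k \<ge> 2 * n \<and> n \<ge> (1::nat)}"
  \<comment> \<open>The monomial u^i w^j arises only from n = j/2 and k = i + j. The row j = 0 is
    the empty index, accounted for by the summand 1.\<close>
  let ?B = "\<lambda>i j. if even j \<and> j \<noteq> 0 then {(i + j, j div 2)} else {}"
  have "has_formal_sum ?f ?A (big_part_series (interpolate (t_value N a)) - 1)"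
  proof (rule has_formal_sumI[where B = ?B])
    fix i j
    show "coeff_uw (big_part_series (interpolate (t_value N a)) - 1) i j =
        (\<Sum>x\<in>?B i j. coeff_uw (?f x) i j)"
    proof (cases "even j \<and> j \<noteq> 0")
      case True
      then obtain n where n: "j = 2 * n" "1 \<le> n" by auto
      then show ?thesis
        using I0_full_height[of n i]
        by (simp add: coeff_uw_monomial coeff_uw_big_part_series
            X0_def t_interp_def interpolate_def)
    next
      case False
      then show ?thesis
        by (auto simp: coeff_uw_big_part_series big_part_indices_0)
    qed
  next
    fix i j x assume "x \<in> ?A" "x \<notin> ?B i j"
    then show "coeff_uw (?f x) i j = 0"
      by (auto simp: coeff_uw_monomial split: if_splits)
  qed (auto elim!: evenE)
  then show ?thesis by (simp add: formal_sum_eqI)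
qed

subsection \<open>Power sums\<close>

text \<open>The complete homogeneous polynomials of two quantities with sum \<open>s\<close> and product \<open>t\<close>.\<close>
fun complete_symmetric :: "'a::comm_ring_1 \<Rightarrow> 'a \<Rightarrow> nat \<Rightarrow> 'a" where
  "complete_symmetric s t 0 = 1"
| "complete_symmetric s t (Suc 0) = s"
| "complete_symmetric s t (Suc (Suc n)) =
     s * complete_symmetric s t (Suc n) - t * complete_symmetric s t n"

text \<open>Both sides satisfy the recurrence with characteristic polynomial X^2 - s X + t. The
  right side mentions only s and t, so it makes sense in the series ring.\<close>

lemma power_sum_eq_complete_symmetric:
  fixes x y :: "'a::comm_ring_1"
  assumes "x + y = s" "x * y = t"
  shows "x ^ Suc n + y ^ Suc n = 2 * complete_symmetric s t (Suc n) - s * complete_symmetric s t n"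
proof (induction n rule: induct_nat_012)
  case 0
  then show ?case using assms by simp
next
  case 1
  then show ?case
    unfolding assms[symmetric] by (simp add: algebra_simps)
next
  case (ge2 n)
  let ?h = "complete_symmetric s t"
  have "x ^ Suc (Suc (Suc n)) + y ^ Suc (Suc (Suc n)) =
      s * (x ^ Suc (Suc n) + y ^ Suc (Suc n)) - t * (x ^ Suc n + y ^ Suc n)"
    unfolding assms[symmetric] by (simp add: algebra_simps)
  then show ?case
    unfolding ge2 by (simp add: algebra_simps)
qed

lemma to_closure_add: "to_closure (F + G) = to_closure F + to_closure G"
  and to_closure_diff: "to_closure (F - G) = to_closure F - to_closure G"
  and to_closure_mult: "to_closure (F * G) = to_closure F * to_closure G"
  and to_closure_1: "to_closure 1 = 1"
  by (simp_all add: to_closure_def One_fract_def[symmetric] flip: to_ac_add to_ac_diff to_ac_mult)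

text \<open>This exhibits the power sums in the closure as images of series, so
  \<open>descend\<close> can be evaluated on them.\<close>

lemma to_closure_complete_symmetric:
  "to_closure (complete_symmetric s t n) = complete_symmetric (to_closure s) (to_closure t) n"
  by (induction s t n rule: complete_symmetric.induct)
    (simp_all add: to_closure_diff to_closure_mult to_closure_1)

text \<open>Summed over n these polynomials give 1 / (1 - u - c w^2), whose term in u^i (c w^2)^l
  has a binomial coefficient. The induction is Pascal's rule.\<close>

lemma coeff_complete_symmetric:
  "coeff_uw (complete_symmetric var_u (- (const_uw c * var_w ^ 2)) n) i j =
     (if even j \<and> i + j = n then of_nat ((i + j div 2) choose (j div 2)) * c ^ (j div 2) else 0)"
proof (induction n arbitrary: i j rule: induct_nat_012)
  case 0
  then show ?case by auto
next
  case 1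
  have "coeff_uw var_u i j = (if i = 1 \<and> j = 0 then 1 else 0)"
    using coeff_uw_var_u_power[of 1] by simp
  then show ?case by (cases "j = 0") auto
next
  case (ge2 n)
  let ?h = "complete_symmetric var_u (- (const_uw c * var_w ^ 2))"
  have rec: "coeff_uw (?h (Suc (Suc n))) i j =
      (if i = 0 then 0 else coeff_uw (?h (Suc n)) (i - 1) j) +
      (if j < 2 then 0 else c * coeff_uw (?h n) i (j - 2))"
  proof -
    have "?h (Suc (Suc n)) = var_u * ?h (Suc n) - const_uw (- c) * (var_w ^ 2 * ?h n)"
      by (simp add: const_uw_def mult.assoc flip: fps_const_neg)
    then show ?thesis
      by (simp only: coeff_uw_diff coeff_uw_const_mult coeff_uw_var_u_mult
          coeff_uw_var_w_power_mult) simp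
  qed
  show ?case
  proof (cases "even j")
    case True
    then obtain l where l: "j = 2 * l" by auto
    have eq: "coeff_uw (?h (Suc (Suc n))) i j =
        (if i = 0 then 0 else if i + 2 * l = Suc (Suc n) then of_nat ((i - 1 + l) choose l) * c ^ l else 0) +
        (if l = 0 then 0 else if i + 2 * l = Suc (Suc n) then of_nat ((i + (l - 1)) choose (l - 1)) * c ^ l else 0)"
      unfolding rec ge2.IH unfolding l by (cases i; cases l) auto
    show ?thesis
    proof (cases "i + 2 * l = Suc (Suc n)")
      case True
      show ?thesis
      proof (cases i; cases l)
        fix k m assume "i = Suc k" "l = Suc m"
        then show ?thesis unfolding eq unfolding l using True by (simp add: distrib_right)
      qed (unfold eq, unfold l, use True in auto)
    next
      case False
      then show ?thesis unfolding eq unfolding l by simp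
    qed
  next
    case False
    then have "j < 2 \<or> odd (j - 2)" by auto
    then show ?thesis unfolding rec ge2.IH using False by auto
  qed
qed

text \<open>The bracket on the left is the coefficient of u^i (c w^2)^l, l = m + 1, in the power sum
  of degree n = i + 2l. The factor n on the right cancels the 1/n of the exponent and leaves the 1/l
  of \<open>log_series\<close>.\<close>

lemma choose_power_sum_identity:
  "real (Suc m) * (2 * real ((i + Suc m) choose Suc m) - real ((i + m) choose Suc m)) =
     real (i + 2 * Suc m) * real ((i + m) choose m)"
proof -
  have "real (Suc m) * real ((i + Suc m) choose Suc m) = real (Suc (i + m)) * real ((i + m) choose m)"
    using Suc_times_binomial_eq[of "i + m" m] by (metis add_Suc_right mult.commute of_nat_mult)
  moreover have "real ((i + Suc m) choose Suc m) = real ((i + m) choose m) + real ((i + m) choose Suc m)"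
    by simp
  ultimately show ?thesis by (simp add: algebra_simps)
qed

lemma coeff_descend_power_sums:
  assumes "\<alpha>1 + \<alpha>2 = to_closure var_u" "\<alpha>1 * \<alpha>2 = to_closure (- (var_r * var_w ^ 2))"
    and "\<gamma>1 + \<gamma>2 = to_closure var_u" "\<gamma>1 * \<gamma>2 = to_closure ((1 - var_r) * var_w ^ 2)"
  shows "coeff_uw (const_uw [:c / real (Suc n):] * descend (\<alpha>1 ^ Suc n + \<alpha>2 ^ Suc n - \<gamma>1 ^ Suc n - \<gamma>2 ^ Suc n)) i j =
    (if i + j = Suc n then coeff_uw (log_series (\<lambda>_. c)) i j else 0)"
proof -
  let ?r = "[:0, 1:] :: real poly"
  define h where "h = (\<lambda>c. complete_symmetric var_u (- (const_uw c * var_w ^ 2)))"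
  define p where "p = (\<lambda>c. 2 * h c (Suc n) - var_u * h c n)"
  \<comment> \<open>Both products have the form -c w^2, with c = r and c = r - 1, so one formula
    covers both pairs.\<close>
  have r: "- (var_r * var_w ^ 2) = - (const_uw ?r * var_w ^ 2)"
    "(1 - var_r) * var_w ^ 2 = - (const_uw (?r - 1) * var_w ^ 2)"
    by (simp only: var_r_def) (simp only: var_r_minus_1 minus_mult_left minus_diff_eq)
  have two: "to_closure 2 = 2"
    using to_closure_add[of 1 1] by (simp add: to_closure_1)
  have "\<alpha>1 ^ Suc n + \<alpha>2 ^ Suc n = to_closure (p ?r)"
    "\<gamma>1 ^ Suc n + \<gamma>2 ^ Suc n = to_closure (p (?r - 1))"
    using power_sum_eq_complete_symmetric[OF assms(1,2), of n]
      power_sum_eq_complete_symmetric[OF assms(3,4), of n]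
    unfolding p_def h_def r
    by (simp_all only: to_closure_diff to_closure_mult two to_closure_complete_symmetric)
  then have "descend (\<alpha>1 ^ Suc n + \<alpha>2 ^ Suc n - \<gamma>1 ^ Suc n - \<gamma>2 ^ Suc n) = p ?r - p (?r - 1)"
    by (metis descend_to_closure diff_diff_eq to_closure_diff)
  moreover have p: "coeff_uw (p c) i j = (if even j \<and> i + j = Suc n then
      of_nat (2 * ((i + j div 2) choose (j div 2))) * c ^ (j div 2)
      - of_nat (if i = 0 then 0 else (i - 1 + j div 2) choose (j div 2)) * c ^ (j div 2) else 0)" for c
    unfolding p_def h_def
    by (auto simp: coeff_uw_two_mult coeff_uw_var_u_mult coeff_complete_symmetric)
  moreover have ?thesis if "even j" "i + j = Suc n"
  proof -
    obtain l where l: "j = 2 * l" using \<open>even j\<close> by auto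
    show ?thesis
    proof (cases l)
      \<comment> \<open>For l = 0 the coefficient does not depend on c, so the two power sums
        cancel.\<close>
      case 0
      then show ?thesis using calculation that l by (auto simp: coeff_uw_log_series)
    next
      case (Suc m)
      \<comment> \<open>At i = 0 the right side is \<open>m choose Suc m\<close>, which is 0, so the
        case distinction disappears.\<close>
      have K: "(if i = 0 then 0 else (i - 1 + Suc m) choose Suc m) = (i + m) choose Suc m"
        by (cases i) auto
      have "coeff_uw (p c) i j = [:2 * real ((i + Suc m) choose Suc m) - real ((i + m) choose Suc m):] * c ^ Suc m" for c
        using p[of c] that l Suc K by (simp add: of_nat_poly smult_diff_left del: binomial_Suc_Suc power_Suc)
      then have "coeff_uw (p ?r) i j - coeff_uw (p (?r - 1)) i j =
          smult (2 * real ((i + Suc m) choose Suc m) - real ((i + m) choose Suc m))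
            (?r ^ Suc m - (?r - 1) ^ Suc m)"
        by (simp add: smult_diff_right del: binomial_Suc_Suc power_Suc)
      moreover have "c / real (Suc n) * (2 * real ((i + Suc m) choose Suc m) - real ((i + m) choose Suc m)) =
          c * real ((i + m) choose m) / real (Suc m)"
      proof -
        have "Suc n = i + 2 * Suc m" using that l Suc by simp
        then show ?thesis
          using choose_power_sum_identity[of m i] by (simp add: field_simps del: of_nat_Suc binomial_Suc_Suc)
      qed
      ultimately show ?thesis
        using \<open>descend _ = _\<close> that l Suc
        by (simp add: mult.commute[of _ c] coeff_uw_log_series del: of_nat_Suc power_Suc binomial_Suc_Suc)
    qed
  qed
  ultimately show ?thesis by (auto simp: coeff_uw_log_series)
qed

theorem corollary3p2:
  fixes N a :: nat
    and \<alpha>1 \<alpha>2 \<gamma>1 \<gamma>2 :: series_closure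
  assumes "N \<ge> 1" and "a \<in> {1..N}"
    and "\<alpha>1 + \<alpha>2 = to_closure var_u" and "\<alpha>1 * \<alpha>2 = to_closure (- (var_r * var_w ^ 2))"
    and "\<gamma>1 + \<gamma>2 = to_closure var_u" and "\<gamma>1 * \<gamma>2 = to_closure ((1 - var_r) * var_w ^ 2)"
  shows "1 + formal_sum (\<lambda>(k, n). const_uw (X0 N a k n n) * var_u ^ (k - 2 * n) * var_w ^ (2 * n))
               {(k, n). k \<ge> 2 * n \<and> n \<ge> 1} =
         exp_uw (formal_sum (\<lambda>n. const_uw [:t_value N a [n] / real n:] *
                                   descend (\<alpha>1 ^ n + \<alpha>2 ^ n - \<gamma>1 ^ n - \<gamma>2 ^ n)) {2..})"
proof -
  let ?f = "\<lambda>n. const_uw [:t_value N a [n] / real n:] *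
    descend (\<alpha>1 ^ n + \<alpha>2 ^ n - \<gamma>1 ^ n - \<gamma>2 ^ n)"
  \<comment> \<open>The n-th term is homogeneous of degree n in u and w together, so u^i w^j occurs
    only for n = i + j.\<close>
  have f: "coeff_uw (?f n) i j =
      (if i + j = n then coeff_uw (log_series (\<lambda>n. t_value N a [n])) i j else 0)" if "n \<in> {2..}" for n i j
  proof -
    obtain m where m: "n = Suc m" using \<open>n \<in> {2..}\<close> by (cases n) auto
    have "coeff_uw (log_series (\<lambda>_. t_value N a [i + j])) i j =
        coeff_uw (log_series (\<lambda>n. t_value N a [n])) i j"
      by (simp add: coeff_uw_log_series)
    then show ?thesis unfolding m coeff_descend_power_sums[OF assms(3-6)] by auto
  qed
  have "has_formal_sum ?f {2..} (log_series (\<lambda>n. t_value N a [n]))"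
  proof (rule has_formal_sumI[where B = "\<lambda>i j. if 2 \<le> i + j then {i + j} else {}"])
    fix i j
    \<comment> \<open>In total degree below 2 only j = 0 has even j, and that row vanishes; so
      starting the sum at n = 2 loses nothing.\<close>
    have "coeff_uw (log_series (\<lambda>n. t_value N a [n])) i j = 0" if "\<not> 2 \<le> i + j"
      using that by (cases "j = 0") (auto simp: coeff_uw_log_series elim!: evenE)
    then show "coeff_uw (log_series (\<lambda>n. t_value N a [n])) i j =
        (\<Sum>n\<in>(if 2 \<le> i + j then {i + j} else {}). coeff_uw (?f n) i j)"
      using f[of "i + j" i j] by simp
  next
    fix i j n :: nat assume "n \<in> {2..}" "n \<notin> (if 2 \<le> i + j then {i + j} else {})"
    then show "coeff_uw (?f n) i j = 0" using f[of n i j] by (auto split: if_splits)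
  qed auto
  then show ?thesis
    unfolding formal_sum_X0 by (simp add: formal_sum_eqI big_part_series_t_value_eq_exp)
qed

end
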